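(* Let $X$ be an $\mathbb{R}^d$-valued random vector with probability density $p>0$ ($\lambda_d$-a.e.), and let $F:\mathbb{R}^d\to\mathbb{R}$ be a Borel function with $\mathbb{E}[F(X)^2]<+\infty$. Assume: (1) $p$ is strictly log-concave and $\lim_{|x|\to+\infty}p(x)=0$. (2) $p$ is twice differentiable and there is $\alpha\in(0,1]$ such that (i) $\left|\frac{Dp}{p}\right|(x)=O(|x|^{\alpha})$ as $|x|\to+\infty$; (ii) there is $C>0$ such that for all $x\in\mathbb{R}^d$, $\frac{1}{p(x)}|D^2p|(x)\le C\left(|x|^{2\alpha}+\frac{1}{|x|^{1-\alpha}}\right)$. (3) $F$ is positive and convex on $\mathbb{R}^d$, (i) $F$ is Lipschitz on $\mathbb{R}^d$, and (ii) there is $a>1$ such that $\mathbb{E}[F^{4a}(X)]<+\infty$ and, for all $M>0$, $\mathbb{E}\left[|X|^{\frac{4a}{a-1}}+e^{M|X|}\right]<+\infty$. (4) For all $\theta\in\mathbb{R}^d$, $\mathbb{E}\left[F^2(X)\frac{p(X)}{p(X-\theta)}\right]<+\infty$; for all $M>0$, $\mathbb{E}\left[F^2(X)|X|^{\alpha}e^{M|X|^{\alpha}}\right]<+\infty$ and $\mathbb{E}\left[F^2(X)|X|^{2\alpha}e^{M|X|^{\alpha}}\right]<+\infty$; and for some $r>1$, for all $M>0$, $\sup_{|\theta|\le M}\mathbb{E}\left[F^{2r}(X+\theta)e^{M|X|^{\alpha}}\frac{1}{|X|^{r(1-\alpha)}}\right]<+\infty$. For each $N\ge1$ let $x^{(N)}$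 be an $L^2$-optimal stationary $N$-quantizer of $X$ with associated Voronoi quantization $\widehat X=\widehat X^{x^{(N)}}$. Let $\theta^*$ be the unique global minimizer of $$Q(\theta)=\mathbb{E}\left[F^2(X)\frac{p(X)}{p(X-\theta)}\right],\qquad \theta\in\mathbb{R}^d,$$ and let $\widehat\theta^N$ be the unique global minimizer of $$\widehat Q_N(\theta)=\mathbb{E}\left[F^2(\widehat X)\frac{p(\widehat X)}{p(\widehat X-\theta)}\right],\qquad \theta\in\mathbb{R}^d.$$ Then $$\widehat\theta^N\to\theta^*\quad\text{and}\quad\widehat Q_N(\widehat\theta^N)\to Q(\theta^* )\quad\text{as }N\to+\infty.$$
   Context: Notation: $|\cdot|$ is the Euclidean norm (or a matrix norm), $\|Y\|_2=(\mathbb{E}|Y|^2)^{1/2}$, $\lambda_d$ is Lebesgue measure on $\mathbb{R}^d$, $Dp$ and $D^2p$ are the gradient and Hessian of $p$. In (2)(ii), $\frac{1}{|x|^{1-\alpha}}$ is read as $+\infty$ at $x=0$ if $\alpha<1$, and as $1$ for all $x$ if $\alpha=1$. Quantization: for an $N$-tuple $x=(x_1,\dots,x_N)\in(\mathbb{R}^d)^N$, let $\mathrm{Proj}_x:\mathbb{R}^d\to\{x_1,\dots,x_N\}$ be a Borel nearest-neighbour projection, $C_i(x)=\mathrm{Proj}_x^{-1}(\{x_i\})$ the Voronoi cells, and $\widehat X^{x}=\mathrm{Proj}_x(X)$ the Voronoi quantization of $X$. The $N$-tuple $x$ is $L^2$-optimal if it minimizes $y\mapsto\left\|\min_{1\le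 i\le N}|X-y_i|\right\|_2$ over $(\mathbb{R}^d)^N$. It is stationary if the $x_i$ are pairwise distinct, $\mathbb{P}(X\in\cup_i\partial C_i(x))=0$ and $\mathbb{E}[X\mid\widehat X^{x}]=\widehat X^{x}$. For $N$ large enough, $F(x_i)\ne0$ for some $i$, and then $\widehat Q_N$ is strictly convex and tends to infinity at infinity, so it has a unique global minimizer $\widehat\theta^N$. *)

theory Defs
  imports "HOL-Probability.Probability"
begin

definition strictly_log_concave :: "('a::real_vector \<Rightarrow> real) \<Rightarrow> bool" where
  "strictly_log_concave p \<longleftrightarrow>
     (\<forall>x. 0 \<le> p x) \<and>
     (\<forall>x y. \<forall>t::real. x \<noteq> y \<and> 0 < t \<and> t < 1 \<longrightarrow>
        p x powr (1 - t) * p y powr t < p ((1 - t) *\<^sub>R x + t *\<^sub>R y))"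

text \<open>The value of 1 / |x|^s with r = |x| and s \<open>\<ge>\<close> 0: it is infinite at r = 0 if s > 0 and
  it is constantly 1 if s = 0. Neither case agrees with the convention \<^term>\<open>0 powr s = (0::real)\<close>
  of the library, hence the case distinction.\<close>

definition recip_powr :: "real \<Rightarrow> real \<Rightarrow> ennreal" where
  "recip_powr r s = (if s = 0 then 1 else if r = 0 then \<infinity> else ennreal (1 / r powr s))"

definition unique_global_minimizer :: "('a \<Rightarrow> real) \<Rightarrow> 'a \<Rightarrow> bool" where
  "unique_global_minimizer f \<theta> \<longleftrightarrow>
     is_arg_min f (\<lambda>_. True) \<theta> \<and> (\<forall>\<eta>. is_arg_min f (\<lambda>_. True) \<eta> \<longrightarrow> \<eta> = \<theta>)"

text \<open>An N-tuple of points is a function \<^typ>\<open>nat \<Rightarrow> 'a\<close> of which only the values at the indices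
  1, ..., N matter.\<close>

definition nearest_neighbour_projection ::
    "nat \<Rightarrow> (nat \<Rightarrow> 'a::euclidean_space) \<Rightarrow> ('a \<Rightarrow> 'a) \<Rightarrow> bool" where
  "nearest_neighbour_projection N x proj \<longleftrightarrow>
     proj \<in> borel_measurable borel \<and>
     (\<forall>z. proj z \<in> x ` {1..N} \<and> (\<forall>i\<in>{1..N}. dist z (proj z) \<le> dist z (x i)))"

definition L2_norm :: "'w measure \<Rightarrow> ('w \<Rightarrow> 'b::real_normed_vector) \<Rightarrow> real" where
  "L2_norm M Y = sqrt (LINT \<omega>|M. (norm (Y \<omega>))\<^sup>2)"

definition L2_optimal ::
    "'w measure \<Rightarrow> ('w \<Rightarrow> 'a::euclidean_space) \<Rightarrow> nat \<Rightarrow> (nat \<Rightarrow> 'a) \<Rightarrow> bool" where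
  "L2_optimal M X N x \<longleftrightarrow>
     is_arg_min (\<lambda>y. L2_norm M (\<lambda>\<omega>. MIN i\<in>{1..N}. norm (X \<omega> - y i))) (\<lambda>_. True) x"

text \<open>The conditional expectation of a vector is taken coordinatewise. It is conditional on the
  sigma-algebra generated by the quantization of X. The Voronoi cells are those of the given
  projection.\<close>

definition stationary_quantizer ::
    "'w measure \<Rightarrow> ('w \<Rightarrow> 'a::euclidean_space) \<Rightarrow> nat \<Rightarrow> (nat \<Rightarrow> 'a) \<Rightarrow> ('a \<Rightarrow> 'a) \<Rightarrow> bool" where
  "stationary_quantizer M X N x proj \<longleftrightarrow>
     inj_on x {1..N} \<and>
     measure M {\<omega> \<in> space M. X \<omega> \<in> (\<Union>i\<in>{1..N}. frontier (proj -` {x i}))} = 0 \<and>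
     (\<forall>b\<in>Basis. AE \<omega> in M.
        real_cond_exp M (vimage_algebra (space M) (\<lambda>\<omega>. proj (X \<omega>)) borel)
          (\<lambda>\<omega>. X \<omega> \<bullet> b) \<omega> = proj (X \<omega>) \<bullet> b)"

text \<open>With Y = X this is the function Q, and with Y the quantization of X it is its quantized
  version.\<close>

definition weighted_second_moment ::
    "'w measure \<Rightarrow> ('a::euclidean_space \<Rightarrow> real) \<Rightarrow> ('a \<Rightarrow> real) \<Rightarrow> ('w \<Rightarrow> 'a) \<Rightarrow> 'a \<Rightarrow> real" where
  "weighted_second_moment M F p Y \<theta> = (LINT \<omega>|M. (F (Y \<omega>))\<^sup>2 * (p (Y \<omega>) / p (Y \<omega> - \<theta>)))"

end

theory Submission
  imports Defs
begin

text \<open>Write \<open>G \<theta> z = F(z)\<^sup>2 p(z) / p(z - \<theta>)\<close>. Since the gradient of \<open>ln p\<close> grows at most linearly and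
  \<open>F\<close> is Lipschitz, \<open>G \<theta> z \<le> C exp (c |z|)\<close> uniformly for \<open>\<theta>\<close> in a bounded set. Optimality of the
  quantizers, compared with the first \<open>N\<close> points of a dense sequence, gives \<open>L\<^sup>2\<close>-convergence of the
  quantizations to \<open>X\<close>; stationarity and the conditional Jensen inequality bound their exponential
  moments by those of \<open>X\<close>. Hence \<open>G \<theta>\<^sub>N\<close> of the quantizations is bounded in \<open>L\<^sup>2\<close>, so uniformly
  integrable, and its expectations converge to \<open>Q \<theta>\<close> whenever \<open>\<theta>\<^sub>N\<close> tends to \<open>\<theta>\<close>. As \<open>1/p\<close> is convex, so
  are the quantized functions. If their minimizers stayed away from \<open>\<theta>\<^sup>*\<close>, then by convexity and
  compactness \<open>Q\<close> would take a value \<open>\<le> Q \<theta>\<^sup>*\<close> on a small sphere around \<open>\<theta>\<^sup>*\<close>.\<close>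

section \<open>Convergence of integrals and of minimizers\<close>

text \<open>If \<open>s\<close> did not converge to \<open>l\<close>, infinitely many terms would
  stay at least some \<open>e\<close> away from \<open>l\<close>, and no subsequence of those tends
  to \<open>l\<close>. This is what makes L2-convergence usable: it gives almost sure convergence
  along subsequences.\<close>

lemma tendsto_if_sub_subsequences:
  fixes s :: "nat \<Rightarrow> 'a::metric_space"
  assumes "\<And>r :: nat \<Rightarrow> nat. strict_mono r \<Longrightarrow> \<exists>q :: nat \<Rightarrow> nat. strict_mono q \<and> (\<lambda>n. s (r (q n))) \<longlonglongrightarrow> l"
  shows "s \<longlonglongrightarrow> l"
proof (rule ccontr)
  assume "\<not> s \<longlonglongrightarrow> l"
  then obtain e where e: "e > 0" and nev: "\<not> (\<forall>\<^sub>F n in sequentially. dist (s n) l < e)"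
    unfolding tendsto_iff by blast
  have "infinite {n. e \<le> dist (s n) l}"
    using nev by (simp add: eventually_cofinite not_less flip: cofinite_eq_sequentially)
  then obtain r :: "nat \<Rightarrow> nat" where r: "strict_mono r" "\<And>n. r n \<in> {n. e \<le> dist (s n) l}"
    using infinite_enumerate by blast
  obtain q where "(\<lambda>n. s (r (q n))) \<longlonglongrightarrow> l"
    using assms[OF r(1)] by blast
  then have "\<forall>\<^sub>F n in sequentially. dist (s (r (q n))) l < e"
    using e by (rule tendstoD)
  then show False
    using r(2) by (force simp: eventually_sequentially not_less[symmetric])
qed

text \<open>Bounded second moments give uniform integrability. Cutting at height \<open>K\<close>
  changes each integral by at most \<open>B' / K\<close>, and the cut functions are bounded by a
  constant, so dominated convergence applies to them.\<close>

lemma (in finite_measure) integral_tendsto_of_bounded_L2: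
  fixes h :: "nat \<Rightarrow> 'a \<Rightarrow> real" and g :: "'a \<Rightarrow> real"
  assumes [measurable]: "\<And>n. h n \<in> borel_measurable M" "g \<in> borel_measurable M"
    and nonneg: "\<And>n x. 0 \<le> h n x" "\<And>x. 0 \<le> g x"
    and int_sq: "\<And>n. integrable M (\<lambda>x. (h n x)\<^sup>2)" "integrable M (\<lambda>x. (g x)\<^sup>2)"
    and bound: "\<And>n. (LINT x|M. (h n x)\<^sup>2) \<le> B"
    and lim: "AE x in M. (\<lambda>n. h n x) \<longlonglongrightarrow> g x"
  shows "(\<lambda>n. LINT x|M. h n x) \<longlonglongrightarrow> (LINT x|M. g x)"
proof (rule LIMSEQ_I)
  fix e :: real
  assume e: "0 < e"
  \<comment> \<open>The common bound also covers \<open>g\<close>, and it is at least 1 so that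
    \<open>K\<close> is positive; \<open>K\<close> is chosen to make \<open>B' / K\<close> equal to
    \<open>e / 3\<close>.\<close>
  define B' where "B' = max 1 (max B (LINT x|M. (g x)\<^sup>2))"
  define K where "K = 3 * B' / e"
  have "0 < B'" and B': "B \<le> B'" "(LINT x|M. (g x)\<^sup>2) \<le> B'"
    by (auto simp: B'_def)
  then have K: "0 < K" "B' / K = e / 3"
    using e by (auto simp: K_def)
  have trunc_bounds: "(LINT x|M. min (f x) K) \<le> (LINT x|M. f x)"
      "(LINT x|M. f x) \<le> (LINT x|M. min (f x) K) + e / 3"
    if [measurable]: "f \<in> borel_measurable M" and f: "\<And>x. 0 \<le> f x" "integrable M (\<lambda>x. (f x)\<^sup>2)"
      "(LINT x|M. (f x)\<^sup>2) \<le> B'" for f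
  proof -
    have intf: "integrable M f"
      by (rule square_integrable_imp_integrable) (use f in auto)
    have intm: "integrable M (\<lambda>x. min (f x) K)"
      by (rule integrable_const_bound[where B = K]) (use f K in auto)
    show "(LINT x|M. min (f x) K) \<le> (LINT x|M. f x)"
      by (rule integral_mono[OF intm intf]) auto
    \<comment> \<open>Where \<open>f\<close> exceeds \<open>K\<close>, it is at most its square
      divided by \<open>K\<close>; elsewhere the truncation changes nothing.\<close>
    have le: "f x \<le> min (f x) K + (f x)\<^sup>2 / K" for x
    proof (cases "f x \<le> K")
      case False
      then have "K * f x \<le> (f x)\<^sup>2"
        using f(1)[of x] unfolding power2_eq_square by (intro mult_right_mono) auto
      then have "f x \<le> (f x)\<^sup>2 / K"
        using K by (simp add: field_simps)
      then show ?thesis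
        using K False by auto
    qed (use K in auto)
    have "(LINT x|M. f x) \<le> (LINT x|M. min (f x) K + (f x)\<^sup>2 / K)"
      using le intm f(2) by (intro integral_mono intf) auto
    also have "\<dots> = (LINT x|M. min (f x) K) + (LINT x|M. (f x)\<^sup>2) / K"
      using intm f(2) by simp
    also have "\<dots> \<le> (LINT x|M. min (f x) K) + e / 3"
      using divide_right_mono[OF f(3), of K] K by linarith
    finally show "(LINT x|M. f x) \<le> (LINT x|M. min (f x) K) + e / 3" .
  qed
  have "(\<lambda>n. LINT x|M. min (h n x) K) \<longlonglongrightarrow> (LINT x|M. min (g x) K)"
  proof (rule integral_dominated_convergence[where w = "\<lambda>_. K"])
    show "AE x in M. (\<lambda>n. min (h n x) K) \<longlonglongrightarrow> min (g x) K"
      using lim by eventually_elim (intro tendsto_min tendsto_const)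
  qed (use nonneg K in auto)
  then obtain N where N: "\<And>n. n \<ge> N \<Longrightarrow>
      norm ((LINT x|M. min (h n x) K) - (LINT x|M. min (g x) K)) < e / 3"
    using LIMSEQ_D[of _ _ "e / 3"] e by (metis divide_pos_pos zero_less_numeral)
  show "\<exists>N. \<forall>n\<ge>N. norm ((LINT x|M. h n x) - (LINT x|M. g x)) < e"
  proof (intro exI allI impI)
    fix n
    assume "N \<le> n"
    have hB: "(LINT x|M. (h n x)\<^sup>2) \<le> B'"
      using bound[of n] B' by linarith
    note h = trunc_bounds[OF assms(1) nonneg(1) int_sq(1) hB]
    note g = trunc_bounds[OF assms(2) nonneg(2) int_sq(2) B'(2)]
    show "norm ((LINT x|M. h n x) - (LINT x|M. g x)) < e"
      using N[OF \<open>N \<le> n\<close>] h g unfolding real_norm_def by linarith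
  qed
qed

text \<open>The exponential bound keeps \<open>G (\<eta> n) (Y n \<omega>)\<close> bounded in L2. A
  sub-subsequence of \<open>Y\<close> converges almost surely to \<open>X\<close>, and joint
  continuity of \<open>G\<close> lets parameter and argument move to their limits together; the L2
  criterion above then applies.\<close>

lemma (in prob_space) integral_tendsto_of_exp_bound:
  fixes X :: "'a \<Rightarrow> 'b::euclidean_space" and Y :: "nat \<Rightarrow> 'a \<Rightarrow> 'b"
    and G :: "'c::topological_space \<Rightarrow> 'b \<Rightarrow> real"
  assumes [measurable]: "X \<in> borel_measurable M" "\<And>n. Y n \<in> borel_measurable M"
      "\<And>\<theta>. G \<theta> \<in> borel_measurable borel"
    and contG: "continuous_on UNIV (\<lambda>(\<theta>, z). G \<theta> z)"
    and nonneg: "\<And>\<theta> z. 0 \<le> G \<theta> z"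
    and G_le: "\<And>n z. G (\<eta> n) z \<le> C * exp (c * norm z)" "\<And>z. G l z \<le> C * exp (c * norm z)"
    and exp_moment: "\<And>n. integrable M (\<lambda>\<omega>. exp (2 * c * norm (Y n \<omega>)))"
      "\<And>n. (LINT \<omega>|M. exp (2 * c * norm (Y n \<omega>))) \<le> B"
      "integrable M (\<lambda>\<omega>. exp (2 * c * norm (X \<omega>)))"
    and L2: "\<And>n. integrable M (\<lambda>\<omega>. (norm (X \<omega> - Y n \<omega>))\<^sup>2)"
      "(\<lambda>n. LINT \<omega>|M. (norm (X \<omega> - Y n \<omega>))\<^sup>2) \<longlonglongrightarrow> 0"
    and \<eta>: "\<eta> \<longlonglongrightarrow> l"
  shows "(\<lambda>n. LINT \<omega>|M. G (\<eta> n) (Y n \<omega>)) \<longlonglongrightarrow> (LINT \<omega>|M. G l (X \<omega>))"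
proof (rule tendsto_if_sub_subsequences)
  fix r :: "nat \<Rightarrow> nat"
  assume r: "strict_mono r"
  have "(\<lambda>n. LINT \<omega>|M. norm ((norm (X \<omega> - Y (r n) \<omega>))\<^sup>2)) \<longlonglongrightarrow> 0"
    using LIMSEQ_subseq_LIMSEQ[OF L2(2) r] by (simp add: o_def)
  from tendsto_L1_AE_subseq[OF L2(1) this]
  obtain q where q: "strict_mono q"
    and ae: "AE \<omega> in M. (\<lambda>n. (norm (X \<omega> - Y (r (q n)) \<omega>))\<^sup>2) \<longlonglongrightarrow> 0"
    by blast
  have rq: "strict_mono (\<lambda>n. r (q n))"
    using strict_mono_o[OF r q] by (simp add: o_def)
  have \<eta>': "(\<lambda>n. \<eta> (r (q n))) \<longlonglongrightarrow> l"
    using LIMSEQ_subseq_LIMSEQ[OF \<eta> rq] by (simp add: o_def)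
  \<comment> \<open>Squaring doubles the exponent, whence the factor 2 in the moment
    hypotheses.\<close>
  have sq: "(G \<theta> z)\<^sup>2 \<le> C\<^sup>2 * exp (2 * c * norm z)" if "\<And>z. G \<theta> z \<le> C * exp (c * norm z)" for \<theta> z
  proof -
    have "(G \<theta> z)\<^sup>2 \<le> (C * exp (c * norm z))\<^sup>2"
      using that nonneg by (rule power_mono)
    also have "\<dots> = C\<^sup>2 * exp (2 * c * norm z)"
      by (simp add: power_mult_distrib mult.assoc flip: exp_double)
    finally show ?thesis .
  qed
  have int_sq: "integrable M (\<lambda>\<omega>. (G \<theta> (Z \<omega>))\<^sup>2)"
    if "\<And>z. G \<theta> z \<le> C * exp (c * norm z)" "integrable M (\<lambda>\<omega>. exp (2 * c * norm (Z \<omega>)))"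
      and [measurable]: "Z \<in> borel_measurable M" for \<theta> Z
  proof (rule Bochner_Integration.integrable_bound)
    show "integrable M (\<lambda>\<omega>. C\<^sup>2 * exp (2 * c * norm (Z \<omega>)))"
      using that by simp
    show "AE \<omega> in M. norm ((G \<theta> (Z \<omega>))\<^sup>2) \<le> norm (C\<^sup>2 * exp (2 * c * norm (Z \<omega>)))"
      using sq[OF that(1)] by (auto simp: abs_mult)
  qed measurable
  have "(\<lambda>n. LINT \<omega>|M. G (\<eta> (r (q n))) (Y (r (q n)) \<omega>)) \<longlonglongrightarrow> (LINT \<omega>|M. G l (X \<omega>))"
  proof (rule integral_tendsto_of_bounded_L2)
    show "(LINT \<omega>|M. (G (\<eta> (r (q n))) (Y (r (q n)) \<omega>))\<^sup>2) \<le> C\<^sup>2 * B" for n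
    proof -
      have "(LINT \<omega>|M. (G (\<eta> (r (q n))) (Y (r (q n)) \<omega>))\<^sup>2)
          \<le> (LINT \<omega>|M. C\<^sup>2 * exp (2 * c * norm (Y (r (q n)) \<omega>)))"
        by (intro integral_mono int_sq sq G_le exp_moment integrable_mult_right) auto
      also have "\<dots> \<le> C\<^sup>2 * B"
        using exp_moment(2) by (simp add: mult_left_mono)
      finally show ?thesis .
    qed
    show "AE \<omega> in M. (\<lambda>n. G (\<eta> (r (q n))) (Y (r (q n)) \<omega>)) \<longlonglongrightarrow> G l (X \<omega>)"
      using ae
    proof eventually_elim
      case (elim \<omega>)
      then have "(\<lambda>n. sqrt ((norm (X \<omega> - Y (r (q n)) \<omega>))\<^sup>2)) \<longlonglongrightarrow> sqrt 0"
        by (rule tendsto_real_sqrt)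
      then have "(\<lambda>n. norm (X \<omega> - Y (r (q n)) \<omega>)) \<longlonglongrightarrow> 0"
        by simp
      then have "(\<lambda>n. dist (Y (r (q n)) \<omega>) (X \<omega>)) \<longlonglongrightarrow> 0"
        by (simp add: dist_norm norm_minus_commute)
      then have "(\<lambda>n. Y (r (q n)) \<omega>) \<longlonglongrightarrow> X \<omega>"
        by (rule tendsto_dist_iff[THEN iffD2])
      then have "(\<lambda>n. (\<eta> (r (q n)), Y (r (q n)) \<omega>)) \<longlonglongrightarrow> (l, X \<omega>)"
        using \<eta>' by (intro tendsto_Pair)
      from continuous_on_tendsto_compose[OF contG this] show ?case
        by simp
    qed
  qed (use int_sq G_le exp_moment nonneg in auto)
  then show "\<exists>q. strict_mono q \<and>
      (\<lambda>n. LINT \<omega>|M. G (\<eta> (r (q n))) (Y (r (q n)) \<omega>)) \<longlonglongrightarrow> (LINT \<omega>|M. G l (X \<omega>))"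
    using q by blast
qed

text \<open>A minimizer far from \<open>v\<close> can be moved along the segment towards
  \<open>v\<close> onto a small sphere, where by convexity \<open>f n\<close> is still at most
  \<open>f n v\<close>. A limit point on the compact sphere contradicts strict minimality of
  \<open>g\<close> at \<open>v\<close>. Convergence with moving arguments is what carries the
  inequality to the limit.\<close>

lemma convex_argmin_tendsto:
  fixes f :: "nat \<Rightarrow> 'a::euclidean_space \<Rightarrow> real"
  assumes convex: "\<And>n. convex_on UNIV (f n)"
    and lim: "\<And>r \<eta> l. strict_mono r \<Longrightarrow> \<eta> \<longlonglongrightarrow> l \<Longrightarrow> (\<lambda>n. f (r n) (\<eta> n)) \<longlonglongrightarrow> g l"
    and min: "\<forall>\<^sub>F n in sequentially. \<forall>y. f n (u n) \<le> f n y"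
    and strict_min: "\<And>y. y \<noteq> v \<Longrightarrow> g v < g y"
  shows "u \<longlonglongrightarrow> v"
proof (rule ccontr)
  assume "\<not> u \<longlonglongrightarrow> v"
  then obtain e where e: "e > 0" and nev: "\<not> (\<forall>\<^sub>F n in sequentially. dist (u n) v < e)"
    unfolding tendsto_iff by blast
  obtain N where N: "\<And>n y. n \<ge> N \<Longrightarrow> f n (u n) \<le> f n y"
    using min by (auto simp: eventually_sequentially)
  \<comment> \<open>The indices are kept beyond \<open>N\<close>, where \<open>u n\<close> minimizes
    \<open>f n\<close>.\<close>
  have "infinite {n. e \<le> dist (u n) v \<and> N \<le> n}"
  proof
    assume "finite {n. e \<le> dist (u n) v \<and> N \<le> n}"
    then have "\<forall>\<^sub>F n in sequentially. \<not> (e \<le> dist (u n) v \<and> N \<le> n)"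
      by (simp add: eventually_cofinite flip: cofinite_eq_sequentially)
    with eventually_ge_at_top[of N] have "\<forall>\<^sub>F n in sequentially. dist (u n) v < e"
      by eventually_elim auto
    with nev show False ..
  qed
  then obtain r :: "nat \<Rightarrow> nat" where r: "strict_mono r"
    and far: "\<And>n. e \<le> dist (u (r n)) v" and ge: "\<And>n. N \<le> r n"
    using infinite_enumerate by blast
  \<comment> \<open>This factor places \<open>\<eta> n\<close> at distance exactly \<open>e\<close>
    from \<open>v\<close>.\<close>
  define t where "t n = e / dist (u (r n)) v" for n
  define \<eta> where "\<eta> n = v + t n *\<^sub>R (u (r n) - v)" for n
  have t: "0 \<le> t n" "t n \<le> 1" for n
    using far[of n] e by (auto simp: t_def divide_le_eq)
  have le: "f (r n) (\<eta> n) \<le> f (r n) v" for n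
  proof -
    have eq: "\<eta> n = (1 - t n) *\<^sub>R v + t n *\<^sub>R u (r n)"
      by (simp add: \<eta>_def algebra_simps)
    have "f (r n) (\<eta> n) \<le> (1 - t n) * f (r n) v + t n * f (r n) (u (r n))"
      unfolding eq using t by (intro convex_onD[OF convex]) auto
    also have "\<dots> \<le> (1 - t n) * f (r n) v + t n * f (r n) v"
      using t N[OF ge] by (intro add_left_mono mult_left_mono) auto
    finally show ?thesis
      by (simp add: algebra_simps)
  qed
  have "\<eta> n \<in> sphere v e" for n
    using far[of n] e by (auto simp: \<eta>_def t_def dist_norm norm_minus_commute)
  then obtain l q where l: "l \<in> sphere v e" and q: "strict_mono q" and lim_\<eta>: "(\<eta> \<circ> q) \<longlonglongrightarrow> l"
    using compact_sphere[of v e] unfolding compact_def by metis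
  have rq: "strict_mono (r \<circ> q)"
    using r q by (rule strict_mono_o)
  have "(\<lambda>n. f ((r \<circ> q) n) ((\<eta> \<circ> q) n)) \<longlonglongrightarrow> g l" "(\<lambda>n. f ((r \<circ> q) n) v) \<longlonglongrightarrow> g v"
    using lim[OF rq lim_\<eta>] lim[OF rq tendsto_const[of v]] by auto
  then have "g l \<le> g v"
    by (rule LIMSEQ_le) (use le in auto)
  moreover have "l \<noteq> v"
    using l e by auto
  ultimately show False
    using strict_min[of l] by simp
qed

section \<open>Exponential moments and mean squared error of quantizations\<close>

text \<open>Some coordinate has absolute value at least \<open>norm z / DIM('a)\<close>, and the
  exponential of an absolute value is one of two signed exponentials. This reduces moments of the
  norm to those of linear forms, where one-dimensional Jensen applies.\<close>

lemma exp_norm_le_sum_Basis: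
  fixes z :: "'a::euclidean_space"
  assumes "0 \<le> c"
  shows "exp (c * norm z) \<le>
    (\<Sum>b\<in>Basis. exp (c * DIM('a) * (z \<bullet> b)) + exp (- (c * DIM('a)) * (z \<bullet> b)))"
proof -
  have "\<exists>b\<in>Basis. norm z \<le> DIM('a) * \<bar>z \<bullet> b\<bar>"
  proof (rule ccontr)
    assume "\<not> ?thesis"
    then have "(\<Sum>b\<in>Basis. \<bar>z \<bullet> b\<bar>) < (\<Sum>b\<in>(Basis :: 'a set). norm z / DIM('a))"
      by (intro sum_strict_mono) (auto simp: field_simps not_le)
    then show False
      using norm_le_l1[of z] by simp
  qed
  then obtain b where b: "b \<in> Basis" "norm z \<le> DIM('a) * \<bar>z \<bullet> b\<bar>"
    by blast
  have "c * norm z \<le> c * (DIM('a) * \<bar>z \<bullet> b\<bar>)"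
    using b assms by (intro mult_left_mono)
  then have "exp (c * norm z) \<le> exp (c * DIM('a) * (z \<bullet> b)) + exp (- (c * DIM('a)) * (z \<bullet> b))"
    by (cases "0 \<le> z \<bullet> b") (auto simp: mult.assoc intro: add_increasing add_increasing2)
  also have "\<dots> \<le> (\<Sum>b\<in>Basis. exp (c * DIM('a) * (z \<bullet> b)) + exp (- (c * DIM('a)) * (z \<bullet> b)))"
    using b by (intro member_le_sum) (auto intro: add_nonneg_nonneg)
  finally show ?thesis .
qed

text \<open>\<open>Y\<close> is the conditional expectation of \<open>X\<close> given the
  sigma-algebra of \<open>Y\<close>, so conditional Jensen bounds the exponential moments of each
  coordinate of \<open>Y\<close> by those of \<open>X\<close>. Both signs and all coordinates
  together give the factor \<open>2 * DIM('b)\<close>. The bound involves \<open>X\<close> only,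
  hence is uniform over quantizations.\<close>

lemma (in prob_space) exp_moment_of_cond_exp_fixed:
  fixes X Y :: "'a \<Rightarrow> 'b::euclidean_space" and c :: real
  assumes [measurable]: "X \<in> borel_measurable M" "Y \<in> borel_measurable M"
    and exp_moment: "\<And>c. integrable M (\<lambda>\<omega>. exp (c * norm (X \<omega>)))"
    and fixed: "\<And>b. b \<in> Basis \<Longrightarrow> AE \<omega> in M.
      real_cond_exp M (vimage_algebra (space M) Y borel) (\<lambda>\<omega>. X \<omega> \<bullet> b) \<omega> = Y \<omega> \<bullet> b"
    and c: "0 \<le> c"
  shows "integrable M (\<lambda>\<omega>. exp (c * norm (Y \<omega>)))"
    "(LINT \<omega>|M. exp (c * norm (Y \<omega>)))
      \<le> 2 * DIM('b) * (LINT \<omega>|M. exp (c * DIM('b) * norm (X \<omega>)))"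
proof -
  define S where "S = vimage_algebra (space M) Y borel"
  have "subalgebra M S"
    unfolding subalgebra_def S_def by (simp add: sets_image_in_sets)
  then interpret finite_measure_subalgebra M S
    by unfold_locales
  \<comment> \<open>Here \<open>d\<close> may have either sign; it is later taken as plus and minus
    \<open>c * DIM('b)\<close>.\<close>
  have coord: "integrable M (\<lambda>\<omega>. exp (d * (Y \<omega> \<bullet> b)))"
    "(LINT \<omega>|M. exp (d * (Y \<omega> \<bullet> b))) \<le> (LINT \<omega>|M. exp (\<bar>d\<bar> * norm (X \<omega>)))"
    if b: "b \<in> Basis" for d b
  proof -
    have abs_le: "d * (X \<omega> \<bullet> b) \<le> \<bar>d\<bar> * norm (X \<omega>)" for \<omega>
      using Basis_le_norm[OF b, of "X \<omega>"] mult_left_mono[of "\<bar>X \<omega> \<bullet> b\<bar>" "norm (X \<omega>)" "\<bar>d\<bar>"]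
      by (metis abs_ge_self abs_ge_zero abs_mult order_trans)
    have intX: "integrable M (\<lambda>\<omega>. X \<omega> \<bullet> b)"
    proof (rule Bochner_Integration.integrable_bound[OF exp_moment[of 1]])
      have "norm (X \<omega> \<bullet> b) \<le> norm (exp (1 * norm (X \<omega>)))" for \<omega>
        using Basis_le_norm[OF b, of "X \<omega>"] exp_ge_add_one_self[of "norm (X \<omega>)"]
        unfolding real_norm_def abs_exp_cancel mult_1 by linarith
      then show "AE \<omega> in M. norm (X \<omega> \<bullet> b) \<le> norm (exp (1 * norm (X \<omega>)))"
        by simp
    qed measurable
    have intE: "integrable M (\<lambda>\<omega>. exp (d * (X \<omega> \<bullet> b)))"
      by (rule Bochner_Integration.integrable_bound[OF exp_moment[of "\<bar>d\<bar>"]]) (use abs_le in auto)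
    have "convex_on UNIV (\<lambda>t. exp (d * t))"
      by (rule f''_ge0_imp_convex[where f' = "\<lambda>t. d * exp (d * t)" and f'' = "\<lambda>t. d * d * exp (d * t)"])
         (auto intro!: derivative_eq_intros)
    then have "AE \<omega> in M. exp (d * real_cond_exp M S (\<lambda>\<omega>. X \<omega> \<bullet> b) \<omega>)
        \<le> real_cond_exp M S (\<lambda>\<omega>. exp (d * (X \<omega> \<bullet> b))) \<omega>"
      by (intro real_cond_exp_jensens_inequality(2)[where I = UNIV and q = "\<lambda>t. exp (d * t)"] intX intE) auto
    with fixed[OF b]
    have ae: "AE \<omega> in M. exp (d * (Y \<omega> \<bullet> b)) \<le> real_cond_exp M S (\<lambda>\<omega>. exp (d * (X \<omega> \<bullet> b))) \<omega>"
      unfolding S_def[symmetric] by eventually_elim simp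
    \<comment> \<open>Integrability also comes from Jensen: the conditional expectation is an
      integrable majorant.\<close>
    show intY: "integrable M (\<lambda>\<omega>. exp (d * (Y \<omega> \<bullet> b)))"
      by (rule Bochner_Integration.integrable_bound[OF real_cond_exp_int(1)[OF intE]])
         (use ae in \<open>auto elim!: eventually_mono\<close>)
    have "(LINT \<omega>|M. exp (d * (Y \<omega> \<bullet> b))) \<le> (LINT \<omega>|M. real_cond_exp M S (\<lambda>\<omega>. exp (d * (X \<omega> \<bullet> b))) \<omega>)"
      by (rule integral_mono_AE[OF intY real_cond_exp_int(1)[OF intE] ae])
    also have "\<dots> = (LINT \<omega>|M. exp (d * (X \<omega> \<bullet> b)))"
      by (rule real_cond_exp_int(2)[OF intE])
    also have "\<dots> \<le> (LINT \<omega>|M. exp (\<bar>d\<bar> * norm (X \<omega>)))"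
      by (rule integral_mono[OF intE exp_moment]) (use abs_le in auto)
    finally show "(LINT \<omega>|M. exp (d * (Y \<omega> \<bullet> b))) \<le> (LINT \<omega>|M. exp (\<bar>d\<bar> * norm (X \<omega>)))" .
  qed
  let ?d = "c * DIM('b)"
  let ?S = "\<lambda>\<omega>. \<Sum>b\<in>Basis. exp (?d * (Y \<omega> \<bullet> b)) + exp (- ?d * (Y \<omega> \<bullet> b))"
  have intS: "integrable M ?S"
    by (intro Bochner_Integration.integrable_sum Bochner_Integration.integrable_add coord)
  show int: "integrable M (\<lambda>\<omega>. exp (c * norm (Y \<omega>)))"
    by (rule Bochner_Integration.integrable_bound[OF intS])
       (use exp_norm_le_sum_Basis[OF c] in \<open>auto intro!: AE_I2 order_trans[OF _ abs_ge_self]\<close>)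
  have "(LINT \<omega>|M. exp (c * norm (Y \<omega>))) \<le> (LINT \<omega>|M. ?S \<omega>)"
    by (rule integral_mono[OF int intS exp_norm_le_sum_Basis[OF c]])
  also have "\<dots> = (\<Sum>b\<in>Basis. (LINT \<omega>|M. exp (?d * (Y \<omega> \<bullet> b))) + (LINT \<omega>|M. exp (- ?d * (Y \<omega> \<bullet> b))))"
    by (subst Bochner_Integration.integral_sum)
       (intro sum.cong refl Bochner_Integration.integral_add Bochner_Integration.integrable_add coord;
         assumption)+
  also have "\<dots> \<le> (\<Sum>b\<in>(Basis :: 'b set). 2 * (LINT \<omega>|M. exp (?d * norm (X \<omega>))))"
  proof (rule sum_mono)
    fix b :: 'b
    assume "b \<in> Basis"
    from coord(2)[OF this, of ?d] coord(2)[OF this, of "- ?d"] c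
    show "(LINT \<omega>|M. exp (?d * (Y \<omega> \<bullet> b))) + (LINT \<omega>|M. exp (- ?d * (Y \<omega> \<bullet> b)))
      \<le> 2 * (LINT \<omega>|M. exp (?d * norm (X \<omega>)))"
      by (simp add: abs_mult)
  qed
  finally show "(LINT \<omega>|M. exp (c * norm (Y \<omega>)))
      \<le> 2 * DIM('b) * (LINT \<omega>|M. exp (?d * norm (X \<omega>)))"
    by (simp add: mult_ac)
qed

text \<open>The projection error is the distance to the grid, so by optimality its mean square is at
  most that of any grid of the same size. For the first points of a dense sequence this distance
  tends to 0 pointwise.\<close>

lemma (in prob_space) optimal_quantization_error_tendsto_0:
  fixes X :: "'a \<Rightarrow> 'b::euclidean_space"
  assumes X [measurable]: "X \<in> borel_measurable M"
    and sq: "integrable M (\<lambda>\<omega>. (norm (X \<omega>))\<^sup>2)"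
    and proj: "\<And>N. N \<ge> 1 \<Longrightarrow> nearest_neighbour_projection N (x N) (proj N)"
    and opt: "\<And>N. N \<ge> 1 \<Longrightarrow> L2_optimal M X N (x N)"
  shows "integrable M (\<lambda>\<omega>. (norm (X \<omega> - proj (Suc n) (X \<omega>)))\<^sup>2)"
    "(\<lambda>n. LINT \<omega>|M. (norm (X \<omega> - proj (Suc n) (X \<omega>)))\<^sup>2) \<longlonglongrightarrow> 0"
proof -
  \<comment> \<open>Counting with \<open>Suc n\<close> keeps the index set of the minimum
    nonempty.\<close>
  define \<delta> where "\<delta> y n \<omega> = (MIN i\<in>{1..Suc n}. norm (X \<omega> - y i))" for y :: "nat \<Rightarrow> 'b" and n \<omega>
  have \<delta>_nonneg: "0 \<le> \<delta> y n \<omega>" for y n \<omega>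
    unfolding \<delta>_def by (intro Min.boundedI) auto
  have \<delta>_le: "\<delta> y n \<omega> \<le> norm (X \<omega> - y i)" if "i \<in> {1..Suc n}" for y n \<omega> i
    unfolding \<delta>_def using that by (intro Min_le) auto
  have int_shift: "integrable M (\<lambda>\<omega>. (norm (X \<omega> - v))\<^sup>2)" for v
  proof (rule Bochner_Integration.integrable_bound)
    show "integrable M (\<lambda>\<omega>. 2 * (norm (X \<omega>))\<^sup>2 + 2 * (norm v)\<^sup>2)"
      using sq by simp
    have "(norm (X \<omega> - v))\<^sup>2 \<le> 2 * (norm (X \<omega>))\<^sup>2 + 2 * (norm v)\<^sup>2" for \<omega>
    proof -
      have "(norm (X \<omega> - v))\<^sup>2 \<le> (norm (X \<omega>) + norm v)\<^sup>2"
        by (intro power_mono norm_triangle_ineq4) auto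
      also have "\<dots> \<le> 2 * (norm (X \<omega>))\<^sup>2 + 2 * (norm v)\<^sup>2"
        using sum_squares_bound[of "norm (X \<omega>)" "norm v"] by (simp add: power2_sum)
      finally show ?thesis .
    qed
    then show "AE \<omega> in M. norm ((norm (X \<omega> - v))\<^sup>2) \<le> norm (2 * (norm (X \<omega>))\<^sup>2 + 2 * (norm v)\<^sup>2)"
      by simp
  qed measurable
  have \<delta>_meas [measurable]: "(\<lambda>\<omega>. \<delta> y n \<omega>) \<in> borel_measurable M" for y n
    unfolding \<delta>_def by measurable
  have int_\<delta>: "integrable M (\<lambda>\<omega>. (\<delta> y n \<omega>)\<^sup>2)" for y n
    by (rule Bochner_Integration.integrable_bound[OF int_shift[of "y 1"]])
       (use \<delta>_nonneg \<delta>_le[of 1] in \<open>auto intro!: power_mono\<close>)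
  have dist_proj: "norm (X \<omega> - proj (Suc n) (X \<omega>)) = \<delta> (x (Suc n)) n \<omega>" for n \<omega>
  proof -
    have p: "proj (Suc n) (X \<omega>) \<in> x (Suc n) ` {1..Suc n}"
      "\<And>i. i \<in> {1..Suc n} \<Longrightarrow> norm (X \<omega> - proj (Suc n) (X \<omega>)) \<le> norm (X \<omega> - x (Suc n) i)"
      using proj[of "Suc n"] unfolding nearest_neighbour_projection_def dist_norm by auto
    show ?thesis
      unfolding \<delta>_def using p by (intro Min_eqI[symmetric]) auto
  qed
  show "integrable M (\<lambda>\<omega>. (norm (X \<omega> - proj (Suc n) (X \<omega>)))\<^sup>2)"
    unfolding dist_proj by (rule int_\<delta>)
  \<comment> \<open>The L2 norm is a square root, so minimality passes to the mean squared
    errors.\<close>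
  have opt_le: "(LINT \<omega>|M. (\<delta> (x (Suc n)) n \<omega>)\<^sup>2) \<le> (LINT \<omega>|M. (\<delta> y n \<omega>)\<^sup>2)" for y n
    using opt[of "Suc n"] unfolding L2_optimal_def L2_norm_def is_arg_min_linorder \<delta>_def by simp
  obtain D :: "'b set" where D: "countable D" "\<And>U. open U \<Longrightarrow> U \<noteq> {} \<Longrightarrow> \<exists>d\<in>D. d \<in> U"
    using countable_dense_setE by blast
  \<comment> \<open>The shift matches grid indices starting at 1 with an enumeration of
    \<open>D\<close> starting at 0.\<close>
  define y where "y i = from_nat_into D (i - 1)" for i
  have dense: "\<exists>j. norm (v - y (Suc j)) < e" if "0 < e" for v e
  proof -
    obtain d where d: "d \<in> D" "d \<in> ball v e"
      using D(2)[of "ball v e"] \<open>0 < e\<close> by auto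
    then obtain j where "d = from_nat_into D j"
      using D(1) from_nat_into_surj by metis
    then show ?thesis
      using d by (auto simp: y_def dist_norm)
  qed
  have "(\<lambda>n. LINT \<omega>|M. (\<delta> y n \<omega>)\<^sup>2) \<longlonglongrightarrow> (LINT \<omega>|M. 0)"
  \<comment> \<open>The point \<open>y 1\<close> belongs to every grid, so the distance to it
    dominates all errors.\<close>
  proof (rule integral_dominated_convergence[where w = "\<lambda>\<omega>. (norm (X \<omega> - y 1))\<^sup>2"])
    have "(\<lambda>n. \<delta> y n \<omega>) \<longlonglongrightarrow> 0" for \<omega>
    proof (rule LIMSEQ_I)
      fix e :: real
      assume "0 < e"
      then obtain j where j: "norm (X \<omega> - y (Suc j)) < e"
        using dense by blast
      have "norm (\<delta> y n \<omega> - 0) < e" if "j \<le> n" for n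
        using \<delta>_le[of "Suc j" n y \<omega>] \<delta>_nonneg[of y n \<omega>] that j by auto
      then show "\<exists>N. \<forall>n\<ge>N. norm (\<delta> y n \<omega> - 0) < e"
        by blast
    qed
    then show "AE \<omega> in M. (\<lambda>n. (\<delta> y n \<omega>)\<^sup>2) \<longlonglongrightarrow> 0"
      by (auto intro!: AE_I2 tendsto_eq_intros)
    show "AE \<omega> in M. norm ((\<delta> y n \<omega>)\<^sup>2) \<le> (norm (X \<omega> - y 1))\<^sup>2" for n
      using \<delta>_nonneg \<delta>_le[of 1] by (auto intro!: AE_I2 power_mono)
  qed (use int_shift in auto)
  then have "(\<lambda>n. LINT \<omega>|M. (\<delta> y n \<omega>)\<^sup>2) \<longlonglongrightarrow> 0"
    by simp
  from tendsto_sandwich[OF _ _ tendsto_const this]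
  show "(\<lambda>n. LINT \<omega>|M. (norm (X \<omega> - proj (Suc n) (X \<omega>)))\<^sup>2) \<longlonglongrightarrow> 0"
    unfolding dist_proj
    using opt_le[of _ y] by simp
qed

section \<open>Log-concave densities and growth of the weighted integrand\<close>

text \<open>Every \<open>z\<close> is the midpoint of two distinct points, and the strict inequality
  puts \<open>p z\<close> above a nonnegative number. Positivity at each point matters because a
  quantization takes its values in a finite set, which is Lebesgue null.\<close>

lemma strictly_log_concave_pos:
  fixes p :: "'a::euclidean_space \<Rightarrow> real"
  assumes "strictly_log_concave p"
  shows "0 < p z"
proof -
  obtain b :: 'a where b: "b \<in> Basis"
    using nonempty_Basis by blast
  then have "z - b \<noteq> z + b"
    using nonzero_Basis[OF b] by (auto simp: algebra_simps simp flip: scaleR_2)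
  then have "p (z - b) powr (1 - 1/2) * p (z + b) powr (1/2)
      < p ((1 - 1/2) *\<^sub>R (z - b) + (1/2) *\<^sub>R (z + b))"
    using assms unfolding strictly_log_concave_def
    by (metis half_gt_zero_iff zero_less_one field_sum_of_halves less_add_same_cancel1)
  moreover have "(1 - 1/2) *\<^sub>R (z - b) + (1/2) *\<^sub>R (z + b) = z"
    by (simp add: algebra_simps flip: scaleR_add_left)
  moreover have "0 \<le> p (z - b) powr (1 - 1/2) * p (z + b) powr (1/2)"
    by simp
  ultimately show ?thesis
    by (metis le_less_trans)
qed

text \<open>\<open>1 / p\<close> is the exponential of the convex function \<open>- ln p\<close>,
  and the exponential is increasing and convex.\<close>

lemma convex_on_inverse_strictly_log_concave:
  fixes p :: "'a::euclidean_space \<Rightarrow> real"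
  assumes slc: "strictly_log_concave p"
  shows "convex_on UNIV (\<lambda>\<theta>. 1 / p (z - \<theta>))"
proof (rule convex_onI)
  fix t :: real and x y :: 'a
  assume t: "0 < t" "t < 1"
  note pos = strictly_log_concave_pos[OF slc]
  show "1 / p (z - ((1 - t) *\<^sub>R x + t *\<^sub>R y)) \<le> (1 - t) * (1 / p (z - x)) + t * (1 / p (z - y))"
  proof (cases "x = y")
    \<comment> \<open>Strict log-concavity speaks of distinct points only, so the degenerate segment
      is treated apart.\<close>
    case True
    have "(1 - t) *\<^sub>R y + t *\<^sub>R y = y"
      by (simp flip: scaleR_add_left)
    with True show ?thesis
      by (simp flip: add_divide_distrib)
  next
    case False
    let ?u = "ln (p (z - x))" and ?v = "ln (p (z - y))"
    have mid: "z - ((1 - t) *\<^sub>R x + t *\<^sub>R y) = (1 - t) *\<^sub>R (z - x) + t *\<^sub>R (z - y)"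
      by (simp add: algebra_simps)
    have "exp ((1 - t) * ?u + t * ?v) = p (z - x) powr (1 - t) * p (z - y) powr t"
      using pos[of "z - x"] pos[of "z - y"] by (simp add: powr_def exp_add)
    also have "\<dots> \<le> p (z - ((1 - t) *\<^sub>R x + t *\<^sub>R y))"
      unfolding mid using slc t False unfolding strictly_log_concave_def by (intro less_imp_le) auto
    finally have "1 / p (z - ((1 - t) *\<^sub>R x + t *\<^sub>R y)) \<le> 1 / exp ((1 - t) * ?u + t * ?v)"
      by (intro divide_left_mono mult_pos_pos pos) auto
    also have "\<dots> = exp ((1 - t) *\<^sub>R (- ?u) + t *\<^sub>R (- ?v))"
      by (simp add: inverse_eq_divide[symmetric] flip: exp_minus)
    also have "\<dots> \<le> (1 - t) * exp (- ?u) + t * exp (- ?v)"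
      using t by (intro convex_onD[OF exp_convex]) auto
    also have "\<dots> = (1 - t) * (1 / p (z - x)) + t * (1 / p (z - y))"
      using pos by (simp add: exp_minus inverse_eq_divide)
    finally show ?thesis .
  qed
qed simp

text \<open>Outside a large ball the growth condition applies, since
  \<open>norm z powr \<alpha>\<close> is at most \<open>1 + norm z\<close>; on the ball the quotient
  is continuous, hence bounded by compactness. The sum of the two constants serves
  everywhere.\<close>

lemma linear_growth_of_log_gradient:
  fixes p :: "'a::euclidean_space \<Rightarrow> real" and Dp :: "'a \<Rightarrow> 'a"
  assumes pos: "\<And>z. 0 < p z"
    and cont: "continuous_on UNIV p" "continuous_on UNIV Dp"
    and \<alpha>: "0 < \<alpha>" "\<alpha> \<le> 1"
    and bigo: "(\<lambda>z. norm (Dp z) / p z) \<in> O[at_infinity](\<lambda>z. norm z powr \<alpha>)"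
  obtains K where "0 \<le> K" "\<And>z. norm (Dp z) / p z \<le> K * (1 + norm z)"
proof -
  obtain c where c: "0 < c"
    "\<forall>\<^sub>F z in at_infinity. norm (norm (Dp z) / p z) \<le> c * norm (norm z powr \<alpha>)"
    using landau_o.bigE[OF bigo] by blast
  then obtain b where b: "\<And>z. b \<le> norm z \<Longrightarrow> norm (Dp z) / p z \<le> c * norm z powr \<alpha>"
    using pos less_imp_le[OF pos] unfolding eventually_at_infinity by auto
  have "compact ((\<lambda>z. norm (Dp z) / p z) ` cball 0 b)"
    using pos by (intro compact_continuous_image continuous_intros continuous_on_subset[OF cont(1)]
      continuous_on_subset[OF cont(2)] compact_cball) (auto simp: less_imp_neq[symmetric])
  then have "bounded ((\<lambda>z. norm (Dp z) / p z) ` cball 0 b)"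
    by (rule compact_imp_bounded)
  then obtain d where d: "0 < d" "\<forall>z\<in>cball 0 b. \<bar>norm (Dp z) / p z\<bar> \<le> d"
    unfolding bounded_pos by auto
  have powr_le: "r powr \<alpha> \<le> 1 + r" if "0 \<le> r" for r :: real
  proof -
    \<comment> \<open>The base \<open>1 + r\<close> is at least 1, so the exponent may then be
      raised to 1.\<close>
    have "r powr \<alpha> \<le> (1 + r) powr \<alpha>"
      using that \<alpha> by (intro powr_mono2) auto
    also have "\<dots> \<le> (1 + r) powr 1"
      using that \<alpha> by (intro powr_mono) auto
    finally show ?thesis
      using that by simp
  qed
  show ?thesis
  proof
    show "0 \<le> c + d"
      using c d by simp
    show "norm (Dp z) / p z \<le> (c + d) * (1 + norm z)" for z
    proof (cases "b \<le> norm z")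
      case True
      then have "norm (Dp z) / p z \<le> c * norm z powr \<alpha>"
        by (rule b)
      also have "\<dots> \<le> c * (1 + norm z)"
        using c powr_le by (intro mult_left_mono) auto
      also have "\<dots> \<le> (c + d) * (1 + norm z)"
        using d by (intro mult_right_mono) auto
      finally show ?thesis .
    next
      case False
      then have "norm (Dp z) / p z \<le> d * 1"
        using d(2) abs_ge_self[of "norm (Dp z) / p z"] by (auto intro: order_trans)
      also have "\<dots> \<le> (c + d) * (1 + norm z)"
        using c d by (intro mult_mono) auto
      finally show ?thesis .
    qed
  qed
qed

text \<open>This is the mean value inequality for \<open>ln p\<close>, whose gradient is
  \<open>Dp / p\<close>, exponentiated.\<close>

lemma shifted_ratio_le_exp:
  fixes p :: "'a::euclidean_space \<Rightarrow> real"
  assumes pos: "\<And>z. 0 < p z"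
    and deriv: "\<And>z. GDERIV p z :> Dp z"
    and K: "0 \<le> K" "\<And>z. norm (Dp z) / p z \<le> K * (1 + norm z)"
  shows "p z / p (z - \<theta>) \<le> exp (K * (1 + norm z + norm \<theta>) * norm \<theta>)"
proof -
  \<comment> \<open>The centred ball of this radius is convex and contains both \<open>z\<close> and
    \<open>z - \<theta>\<close>.\<close>
  let ?R = "norm z + norm \<theta>"
  have "norm (ln (p z) - ln (p (z - \<theta>))) \<le> K * (1 + ?R) * norm (z - (z - \<theta>))"
  proof (rule differentiable_bound[where S = "cball 0 ?R"])
    fix w :: 'a
    assume w: "w \<in> cball 0 ?R"
    have "(p has_derivative (\<lambda>h. h \<bullet> Dp w)) (at w within cball 0 ?R)"
      using deriv[of w] unfolding gderiv_def by (rule has_derivative_at_withinI)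
    from has_derivative_ln[OF pos this]
    show "((\<lambda>w. ln (p w)) has_derivative (\<lambda>h. h \<bullet> Dp w / p w)) (at w within cball 0 ?R)"
      by (simp add: divide_inverse)
    show "onorm (\<lambda>h. h \<bullet> Dp w / p w) \<le> K * (1 + ?R)"
    proof (rule onorm_le)
      fix h
      have "norm (h \<bullet> Dp w / p w) \<le> norm h * norm (Dp w) / p w"
        using Cauchy_Schwarz_ineq2[of h "Dp w"] pos[of w] by (simp add: divide_right_mono)
      also have "\<dots> = norm (Dp w) / p w * norm h"
        by simp
      also have "\<dots> \<le> K * (1 + ?R) * norm h"
        using order_trans[OF K(2)[of w] mult_left_mono[OF _ K(1), of _ "1 + ?R"]] w
        by (intro mult_right_mono) auto
      finally show "norm (h \<bullet> Dp w / p w) \<le> K * (1 + ?R) * norm h" .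
    qed
  qed (auto intro: order_trans[OF norm_triangle_ineq4])
  then have "ln (p z / p (z - \<theta>)) \<le> K * (1 + norm z + norm \<theta>) * norm \<theta>"
    using pos[of z] pos[of "z - \<theta>"] by (simp add: ln_div add.assoc abs_le_iff)
  then have "exp (ln (p z / p (z - \<theta>))) \<le> exp (K * (1 + norm z + norm \<theta>) * norm \<theta>)"
    by simp
  then show ?thesis
    using pos[of z] pos[of "z - \<theta>"] by simp
qed

text \<open>For bounded \<open>\<theta>\<close> the exponent in the previous bound is at most affine
  in \<open>norm z\<close>, and a Lipschitz function is at most a multiple of
  \<open>exp (norm z)\<close>.\<close>

lemma weighted_ratio_exp_bound:
  fixes p F :: "'a::euclidean_space \<Rightarrow> real"
  assumes pos: "\<And>z. 0 < p z"
    and deriv: "\<And>z. GDERIV p z :> Dp z"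
    and K: "0 \<le> K" "\<And>z. norm (Dp z) / p z \<le> K * (1 + norm z)"
    and lip: "L-lipschitz_on UNIV F"
  obtains C c where "0 \<le> c"
    "\<And>\<theta> z. norm \<theta> \<le> R \<Longrightarrow> (F z)\<^sup>2 * (p z / p (z - \<theta>)) \<le> C * exp (c * norm z)"
proof
  define A where "A = \<bar>F 0\<bar> + L"
  have L: "0 \<le> L"
    using lip by (rule lipschitz_on_nonneg)
  have F: "(F z)\<^sup>2 \<le> A\<^sup>2 * exp (2 * norm z)" for z
  proof -
    have "\<bar>F z\<bar> \<le> \<bar>F 0\<bar> + L * norm z"
      using lipschitz_onD[OF lip, of z 0] by (simp add: dist_norm)
    also have "\<dots> \<le> \<bar>F 0\<bar> * exp (norm z) + L * exp (norm z)"
      using L order_trans[OF _ exp_ge_add_one_self[of "norm z"]]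
      by (intro add_mono mult_left_mono) (auto simp: mult_le_cancel_left1)
    also have "\<dots> = A * exp (norm z)"
      by (simp add: A_def algebra_simps)
    finally have "\<bar>F z\<bar>\<^sup>2 \<le> (A * exp (norm z))\<^sup>2"
      by (intro power_mono) auto
    then show ?thesis
      by (simp add: power_mult_distrib flip: exp_double)
  qed
  \<comment> \<open>The 2 comes from the square of \<open>F\<close>. The absolute value keeps the
    exponent nonnegative even for negative \<open>R\<close>, when no \<open>\<theta>\<close>
    qualifies.\<close>
  show "0 \<le> 2 + K * \<bar>R\<bar>"
    using K by simp
  show "(F z)\<^sup>2 * (p z / p (z - \<theta>)) \<le> A\<^sup>2 * exp (K * (1 + \<bar>R\<bar>) * \<bar>R\<bar>) * exp ((2 + K * \<bar>R\<bar>) * norm z)"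
    if "norm \<theta> \<le> R" for \<theta> z
  proof -
    have R: "norm \<theta> \<le> \<bar>R\<bar>"
      using that by simp
    have "p z / p (z - \<theta>) \<le> exp (K * (1 + norm z + norm \<theta>) * norm \<theta>)"
      by (rule shifted_ratio_le_exp[OF pos deriv K])
    also have "\<dots> \<le> exp (K * (1 + norm z + \<bar>R\<bar>) * \<bar>R\<bar>)"
      using R K by (auto intro!: mult_mono)
    finally have "(F z)\<^sup>2 * (p z / p (z - \<theta>))
        \<le> A\<^sup>2 * exp (2 * norm z) * exp (K * (1 + norm z + \<bar>R\<bar>) * \<bar>R\<bar>)"
      using less_imp_le[OF pos] by (intro mult_mono F) auto
    also have "\<dots> = A\<^sup>2 * exp (K * (1 + \<bar>R\<bar>) * \<bar>R\<bar>) * exp ((2 + K * \<bar>R\<bar>) * norm z)"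
      by (simp add: algebra_simps flip: exp_add)
    finally show ?thesis .
  qed
qed

section \<open>Convergence of the minimizers and of the minimal values\<close>

theorem proposition2p2:
  fixes M :: "'w measure"
    and X :: "'w \<Rightarrow> 'a::euclidean_space"
    and p F :: "'a \<Rightarrow> real"
    and Dp :: "'a \<Rightarrow> 'a"
    and D2p :: "'a \<Rightarrow> 'a \<Rightarrow> 'a"
    and \<alpha> a r :: real
    and x :: "nat \<Rightarrow> nat \<Rightarrow> 'a"
    and proj :: "nat \<Rightarrow> 'a \<Rightarrow> 'a"
    and \<theta>star :: 'a
    and \<theta>hat :: "nat \<Rightarrow> 'a"
  assumes "prob_space M"
    and "distributed M lborel X (\<lambda>z. ennreal (p z))"
    and "AE z in lborel. 0 < p z"
    and "F \<in> borel_measurable borel"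
    and "(\<integral>\<^sup>+\<omega>. ennreal ((F (X \<omega>))\<^sup>2) \<partial>M) < \<infinity>"
    and H1: "strictly_log_concave p"
      "(p \<longlongrightarrow> 0) at_infinity"
    and H2: "0 < \<alpha>" "\<alpha> \<le> 1"
      "\<forall>z. GDERIV p z :> Dp z"
      "\<forall>z. (Dp has_derivative D2p z) (at z)"
      "(\<lambda>z. norm (Dp z) / p z) \<in> O[at_infinity](\<lambda>z. norm z powr \<alpha>)"
      "\<exists>C>0. \<forall>z. ennreal (1 / p z * onorm (D2p z))
         \<le> ennreal C * (ennreal (norm z powr (2 * \<alpha>)) + recip_powr (norm z) (1 - \<alpha>))"
    and H3: "\<forall>z. 0 \<le> F z"
      "convex_on UNIV F"
      "\<exists>L. L-lipschitz_on UNIV F"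
      "1 < a"
      "(\<integral>\<^sup>+\<omega>. ennreal (F (X \<omega>) powr (4 * a)) \<partial>M) < \<infinity>"
      "\<forall>m>0. (\<integral>\<^sup>+\<omega>. ennreal (norm (X \<omega>) powr (4 * a / (a - 1)) + exp (m * norm (X \<omega>))) \<partial>M) < \<infinity>"
    and H4: "\<forall>\<theta>. (\<integral>\<^sup>+\<omega>. ennreal ((F (X \<omega>))\<^sup>2 * (p (X \<omega>) / p (X \<omega> - \<theta>))) \<partial>M) < \<infinity>"
      "\<forall>m>0. (\<integral>\<^sup>+\<omega>. ennreal ((F (X \<omega>))\<^sup>2 * norm (X \<omega>) powr \<alpha>
         * exp (m * norm (X \<omega>) powr \<alpha>)) \<partial>M) < \<infinity>"
      "\<forall>m>0. (\<integral>\<^sup>+\<omega>. ennreal ((F (X \<omega>))\<^sup>2 * norm (X \<omega>) powr (2 * \<alpha>)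
         * exp (m * norm (X \<omega>) powr \<alpha>)) \<partial>M) < \<infinity>"
      "1 < r"
      "\<forall>m>0. (SUP \<theta>\<in>cball 0 m.
         \<integral>\<^sup>+\<omega>. ennreal (F (X \<omega> + \<theta>) powr (2 * r) * exp (m * norm (X \<omega>) powr \<alpha>))
           * recip_powr (norm (X \<omega>)) (r * (1 - \<alpha>)) \<partial>M) < \<infinity>"
    and quantizers: "\<forall>N\<ge>1. nearest_neighbour_projection N (x N) (proj N)"
      "\<forall>N\<ge>1. L2_optimal M X N (x N)"
      "\<forall>N\<ge>1. stationary_quantizer M X N (x N) (proj N)"
    and minimizers: "unique_global_minimizer (weighted_second_moment M F p X) \<theta>star"
      "\<forall>\<^sub>F N in sequentially.
         unique_global_minimizer (weighted_second_moment M F p (\<lambda>\<omega>. proj N (X \<omega>))) (\<theta>hat N)"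
  shows "\<theta>hat \<longlonglongrightarrow> \<theta>star \<and>
    (\<lambda>N. weighted_second_moment M F p (\<lambda>\<omega>. proj N (X \<omega>)) (\<theta>hat N))
      \<longlonglongrightarrow> weighted_second_moment M F p X \<theta>star"
proof -
  interpret prob_space M
    by fact
  let ?W = "weighted_second_moment M F p"
  define G where "G \<theta> z = (F z)\<^sup>2 * (p z / p (z - \<theta>))" for \<theta> z
  have W_eq: "?W Z \<theta> = (LINT \<omega>|M. G \<theta> (Z \<omega>))" for Z \<theta>
    by (simp add: weighted_second_moment_def G_def)
  have pos: "0 < p z" for z
    by (rule strictly_log_concave_pos[OF H1(1)])
  have deriv: "GDERIV p z :> Dp z" for z
    using H2(3) by blast
  have cont_p: "continuous_on UNIV p"
    using deriv unfolding gderiv_def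
    by (meson has_derivative_continuous continuous_at_imp_continuous_on)
  have cont_Dp: "continuous_on UNIV Dp"
    using H2(4) by (meson has_derivative_continuous continuous_at_imp_continuous_on)
  obtain L where lip: "L-lipschitz_on UNIV F"
    using H3(3) by blast
  have cont_F: "continuous_on UNIV F"
    using lip by (rule lipschitz_on_continuous_on)
  have cont_G: "continuous_on UNIV (\<lambda>(\<theta>, z). G \<theta> z)"
    unfolding G_def case_prod_unfold using less_imp_neq[OF pos]
    by (intro continuous_intros continuous_on_compose2[OF cont_p] continuous_on_compose2[OF cont_F])
      (auto simp: less_imp_neq[symmetric])
  have G_nonneg: "0 \<le> G \<theta> z" for \<theta> z
    using less_imp_le[OF pos] by (simp add: G_def)
  have G_meas [measurable]: "G \<theta> \<in> borel_measurable borel" for \<theta>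
  proof (rule borel_measurable_continuous_onI)
    have "continuous_on UNIV (\<lambda>z. (\<theta>, z))"
      by (intro continuous_intros)
    from continuous_on_compose2[OF cont_G this] show "continuous_on UNIV (G \<theta>)"
      by simp
  qed
  obtain K where K: "0 \<le> K" "\<And>z. norm (Dp z) / p z \<le> K * (1 + norm z)"
    using linear_growth_of_log_gradient[OF pos cont_p cont_Dp H2(1,2,5)] by blast
  have G_bound: "\<exists>C c. 0 \<le> c \<and> (\<forall>\<theta> z. norm \<theta> \<le> R \<longrightarrow> G \<theta> z \<le> C * exp (c * norm z))" for R
    using weighted_ratio_exp_bound[OF pos deriv K lip, of R] unfolding G_def by metis

  have X [measurable]: "X \<in> borel_measurable M"
    using assms(2) by (simp add: distributed_def)
  \<comment> \<open>Any real \<open>c\<close> is allowed: \<open>max 1 c\<close> is positive, as the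
    moment hypothesis demands, and the power of the norm only adds a nonnegative term.\<close>
  have exp_moment: "integrable M (\<lambda>\<omega>. exp (c * norm (X \<omega>)))" for c
  proof (rule integrableI_bounded)
    have "ennreal (norm (exp (c * norm (X \<omega>)))) \<le> ennreal (norm (X \<omega>) powr (4 * a / (a - 1))
        + exp (max 1 c * norm (X \<omega>)))" for \<omega>
      by (intro ennreal_leI) (auto intro!: add_increasing mult_right_mono)
    then have "(\<integral>\<^sup>+\<omega>. ennreal (norm (exp (c * norm (X \<omega>)))) \<partial>M)
        \<le> (\<integral>\<^sup>+\<omega>. ennreal (norm (X \<omega>) powr (4 * a / (a - 1)) + exp (max 1 c * norm (X \<omega>))) \<partial>M)"
      by (intro nn_integral_mono)
    also have "\<dots> < \<infinity>"
      using H3(6)[rule_format, of "max 1 c"] by simp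
    finally show "(\<integral>\<^sup>+\<omega>. ennreal (norm (exp (c * norm (X \<omega>)))) \<partial>M) < \<infinity>" .
  qed measurable
  have sq: "integrable M (\<lambda>\<omega>. (norm (X \<omega>))\<^sup>2)"
  proof (rule Bochner_Integration.integrable_bound[OF exp_moment[of 2]])
    have "(norm (X \<omega>))\<^sup>2 \<le> (exp (norm (X \<omega>)))\<^sup>2" for \<omega>
      using order_trans[OF _ exp_ge_add_one_self[of "norm (X \<omega>)"]] by (intro power_mono) auto
    then show "AE \<omega> in M. norm ((norm (X \<omega>))\<^sup>2) \<le> norm (exp (2 * norm (X \<omega>)))"
      by (simp flip: exp_double)
  qed measurable

  \<comment> \<open>The index is shifted by one because quantizers are given for \<open>N\<close> at
    least 1; the shift is undone at the end.\<close>
  define Y where "Y n \<omega> = proj (Suc n) (X \<omega>)" for n \<omega>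
  have proj_meas [measurable]: "proj (Suc n) \<in> borel_measurable borel" for n
    using quantizers(1) by (simp add: nearest_neighbour_projection_def)
  have Y [measurable]: "Y n \<in> borel_measurable M" for n
    unfolding Y_def by measurable
  have error: "integrable M (\<lambda>\<omega>. (norm (X \<omega> - Y n \<omega>))\<^sup>2)"
    "(\<lambda>n. LINT \<omega>|M. (norm (X \<omega> - Y n \<omega>))\<^sup>2) \<longlonglongrightarrow> 0" for n
    unfolding Y_def using quantizers
    by (auto intro: optimal_quantization_error_tendsto_0[OF X sq, of x proj])
  have stationary: "AE \<omega> in M.
      real_cond_exp M (vimage_algebra (space M) (Y n) borel) (\<lambda>\<omega>. X \<omega> \<bullet> b) \<omega> = Y n \<omega> \<bullet> b"
    if "b \<in> Basis" for n b
    using quantizers(3) that by (simp add: stationary_quantizer_def Y_def[abs_def])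
  note Y_moment = exp_moment_of_cond_exp_fixed[OF X Y exp_moment stationary]

  have "convex_on UNIV (?W (Y n))" for n
  proof -
    have int: "integrable M (\<lambda>\<omega>. G \<theta> (Y n \<omega>))" for \<theta>
    proof -
      obtain C c where c: "0 \<le> c" "\<And>z. G \<theta> z \<le> C * exp (c * norm z)"
        using G_bound[of "norm \<theta>"] by blast
      show ?thesis
        by (rule Bochner_Integration.integrable_bound[OF integrable_mult_right[OF Y_moment(1)[OF _ c(1)], of C]])
          (use c(2) G_nonneg in \<open>auto intro: order_trans[OF _ abs_ge_self]\<close>)
    qed
    show ?thesis
    proof (rule convex_onI)
      fix t :: real and u v :: 'a
      assume t: "0 < t" "t < 1"
      \<comment> \<open>For fixed \<open>z\<close>, \<open>G \<theta> z\<close> is a nonnegative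
        multiple of \<open>1 / p (z - \<theta>)\<close>, which is convex in
        \<open>\<theta>\<close>.\<close>
      have le: "G ((1 - t) *\<^sub>R u + t *\<^sub>R v) z \<le> (1 - t) * G u z + t * G v z" for z
      proof -
        have "(F z)\<^sup>2 * p z * (1 / p (z - ((1 - t) *\<^sub>R u + t *\<^sub>R v)))
            \<le> (F z)\<^sup>2 * p z * ((1 - t) * (1 / p (z - u)) + t * (1 / p (z - v)))"
          using t less_imp_le[OF pos]
          by (intro mult_left_mono convex_onD[OF convex_on_inverse_strictly_log_concave[OF H1(1)]]) auto
        then show ?thesis
          by (simp add: G_def algebra_simps)
      qed
      have "?W (Y n) ((1 - t) *\<^sub>R u + t *\<^sub>R v) \<le> (LINT \<omega>|M. (1 - t) * G u (Y n \<omega>) + t * G v (Y n \<omega>))"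
        unfolding W_eq by (intro integral_mono int le) (use int in simp)
      also have "\<dots> = (1 - t) * ?W (Y n) u + t * ?W (Y n) v"
        unfolding W_eq using int by simp
      finally show "?W (Y n) ((1 - t) *\<^sub>R u + t *\<^sub>R v) \<le> (1 - t) * ?W (Y n) u + t * ?W (Y n) v" .
    qed simp
  qed
  \<comment> \<open>Continuous convergence along every subsequence serves twice: for the minimizers,
    and then for the minimal values.\<close>
  moreover have lim: "(\<lambda>n. ?W (Y (r n)) (\<eta> n)) \<longlonglongrightarrow> ?W X l"
    if r: "strict_mono r" and \<eta>: "\<eta> \<longlonglongrightarrow> l" for r \<eta> l
  proof -
    \<comment> \<open>A convergent sequence is bounded, so a single exponential bound covers all
      \<open>\<eta> n\<close> and the limit \<open>l\<close>.\<close>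
    obtain R where "\<And>n. norm (\<eta> n) \<le> R"
      using convergent_imp_Bseq[OF convergentI[OF \<eta>]] unfolding Bseq_def by blast
    moreover obtain C c where c: "0 \<le> c"
      "\<And>\<theta> z. norm \<theta> \<le> max R (norm l) \<Longrightarrow> G \<theta> z \<le> C * exp (c * norm z)"
      using G_bound[of "max R (norm l)"] by blast
    ultimately have G_le: "G (\<eta> n) z \<le> C * exp (c * norm z)" "G l z \<le> C * exp (c * norm z)" for n z
      by (auto simp: le_max_iff_disj)
    have "0 \<le> 2 * c"
      using c(1) by simp
    note moment = Y_moment[OF _ this]
    show ?thesis
      unfolding W_eq
      by (rule integral_tendsto_of_exp_bound[OF X Y G_meas cont_G G_nonneg G_le moment exp_moment
            error(1) _ \<eta>])
        (use LIMSEQ_subseq_LIMSEQ[OF error(2) r] in \<open>auto simp: o_def\<close>)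
  qed
  moreover have "\<forall>\<^sub>F n in sequentially. \<forall>y. ?W (Y n) (\<theta>hat (Suc n)) \<le> ?W (Y n) y"
  proof -
    have "\<forall>\<^sub>F n in sequentially. unique_global_minimizer (?W (\<lambda>\<omega>. proj (Suc n) (X \<omega>))) (\<theta>hat (Suc n))"
      using minimizers(2) by (subst eventually_sequentially_Suc)
    then show ?thesis
      by eventually_elim (simp add: unique_global_minimizer_def is_arg_min_linorder Y_def[abs_def])
  qed
  \<comment> \<open>Uniqueness makes the minimum strict: a point with no larger value would be a
    second minimizer.\<close>
  moreover have "?W X \<theta>star < ?W X y" if "y \<noteq> \<theta>star" for y
    using minimizers(1) that unfolding unique_global_minimizer_def is_arg_min_linorder
    by (metis linorder_not_le order_trans)
  ultimately have \<theta>: "(\<lambda>n. \<theta>hat (Suc n)) \<longlonglongrightarrow> \<theta>star"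
    by (rule convex_argmin_tendsto)
  \<comment> \<open>The minimizers now form a convergent sequence of arguments, so their values
    converge as well.\<close>
  from lim[OF strict_mono_id this]
  have "(\<lambda>n. ?W (\<lambda>\<omega>. proj (Suc n) (X \<omega>)) (\<theta>hat (Suc n))) \<longlonglongrightarrow> ?W X \<theta>star"
    by (simp add: Y_def[abs_def])
  then have "(\<lambda>N. ?W (\<lambda>\<omega>. proj N (X \<omega>)) (\<theta>hat N)) \<longlonglongrightarrow> ?W X \<theta>star"
    by (rule filterlim_sequentially_Suc[THEN iffD1])
  moreover have "\<theta>hat \<longlonglongrightarrow> \<theta>star"
    using \<theta> by (rule filterlim_sequentially_Suc[THEN iffD1])
  ultimately show ?thesis
    by simp
qed

end
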